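(* Let $A$ be an arbitrary unital C$^*$-algebra. If $P,Q\in\mathcal{P}(A)$ have a greatest lower bound in $\mathcal{S}(A)$ then they necessarily commute, i.e. $PQ=QP$.
   Context: C$^*$-algebras are over the scalar field $\mathbb{F}=\mathbb{R}$ or $\mathbb{C}$ and are (isomorphic to) norm-closed self-adjoint subalgebras of $\mathcal{B}(H)$ for some Hilbert space $H$ over $\mathbb{F}$. $\mathcal{P}(A)$ is the set of projections (self-adjoint idempotents) of $A$ and $\mathcal{S}(A)$ is the set of all self-adjoint elements of $A$, ordered by $S\leq T\Leftrightarrow T-S$ is positive. *)

theory Defs
  imports "HOL-Analysis.Analysis"
begin

text \<open>
  The scalar field is \<open>\<real>\<close> or \<open>\<complex>\<close>, each with its usual absolute value and conjugation.
  These are, up to isomorphism, the only instances of the following class: see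
  \<open>real_or_complex_cases\<close> below.
\<close>

class real_or_complex = real_normed_field +
  fixes conjugate :: "'a \<Rightarrow> 'a"
  assumes conjugate_add: "conjugate (a + b) = conjugate a + conjugate b"
    and conjugate_mult: "conjugate (a * b) = conjugate a * conjugate b"
    and conjugate_conjugate: "conjugate (conjugate a) = a"
    and conjugate_scaleR: "conjugate (r *\<^sub>R a) = r *\<^sub>R conjugate a"
    and mult_conjugate: "a * conjugate a = (norm a)\<^sup>2 *\<^sub>R 1"

instantiation real :: real_or_complex
begin
definition conjugate_real :: "real \<Rightarrow> real" where "conjugate_real = id"
instance by standard (auto simp: conjugate_real_def power2_eq_square)
end

instantiation complex :: real_or_complex
begin
definition conjugate_complex :: "complex \<Rightarrow> complex" where "conjugate_complex = cnj"
instance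
  by standard
    (auto simp: conjugate_complex_def scaleR_conv_of_real complex_norm_square simp flip: of_real_power)
end

lemma conjugate_of_real: "conjugate (of_real r :: 'a :: real_or_complex) = of_real r"
proof -
  have "conjugate (1 :: 'a) = 1"
    using mult_conjugate[of "1 :: 'a"] by simp
  then show ?thesis
    using conjugate_scaleR[of r "1 :: 'a"] by (simp add: of_real_def)
qed

lemma real_or_complex_cases:
  obtains (real) "range (of_real :: real \<Rightarrow> 'a :: real_or_complex) = UNIV"
  | (complex) i :: "'a :: real_or_complex" where "i * i = -1" "conjugate i = -i"
      "\<And>z. \<exists>a b. z = of_real a + of_real b * i"
proof (cases "range (of_real :: real \<Rightarrow> 'a) = UNIV")
  case False
  have c1: "conjugate (1 :: 'a) = 1"
    using conjugate_of_real[of 1, where ?'a = 'a] by simp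
  have mc: "z * conjugate z = of_real ((norm z)\<^sup>2)" for z :: 'a
    by (simp add: mult_conjugate of_real_def)
  have tr: "\<exists>r. z + conjugate z = of_real (2 * r)" for z :: 'a
  proof -
    have "(z + 1) * conjugate (z + 1) = z * conjugate z + z + conjugate z + 1"
      by (simp add: conjugate_add c1 algebra_simps)
    then have "z + conjugate z = of_real ((norm (z + 1))\<^sup>2 - (norm z)\<^sup>2 - 1)"
      unfolding mc by (simp add: algebra_simps)
    then show ?thesis
      by (intro exI[of _ "((norm (z + 1))\<^sup>2 - (norm z)\<^sup>2 - 1) / 2"]) simp
  qed
  have fixed: "\<exists>r. z = of_real r" if "conjugate z = z" for z :: 'a
  proof -
    obtain r where "z + conjugate z = of_real (2 * r)" using tr by blast
    then have "2 * z = 2 * of_real r" using that by simp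
    then show ?thesis by (metis mult_left_cancel zero_neq_numeral)
  qed
  have imag: "\<exists>r y. z = of_real r + y \<and> conjugate y = - y" for z :: 'a
  proof -
    obtain r where r: "z + conjugate z = of_real (2 * r)" using tr by blast
    have "conjugate (z - of_real r) = conjugate z - of_real r"
      using conjugate_add[of z "of_real (- r)"] conjugate_of_real[of "- r", where ?'a = 'a] by simp
    also have "\<dots> = - (z - of_real r)"
      using r by (simp add: eq_neg_iff_add_eq_0 algebra_simps)
    finally show ?thesis
      by (intro exI[of _ r] exI[of _ "z - of_real r"]) simp
  qed
  obtain w :: 'a where w: "w \<notin> range of_real" using False by blast
  obtain r0 y where y: "w = of_real r0 + y" "conjugate y = - y" using imag by blast
  have "y \<noteq> 0" using w y by auto
  define i where "i = y / of_real (norm y)"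
  have ni: "norm i = 1" using \<open>y \<noteq> 0\<close> by (simp add: i_def norm_divide)
  have ci: "conjugate i = - i"
    using y(2) conjugate_scaleR[of "inverse (norm y)" y]
    by (simp add: i_def scaleR_conv_of_real divide_inverse mult.commute)
  have ii: "i * i = -1" using mc[of i] by (simp add: ni ci) (metis minus_equation_iff)
  have "\<exists>a b. z = of_real a + of_real b * i" for z :: 'a
  proof -
    obtain a u where u: "z = of_real a + u" "conjugate u = - u" using imag by blast
    have "conjugate (u * i) = u * i" by (simp add: conjugate_mult u(2) ci)
    then obtain b where b: "u * i = of_real b" using fixed by blast
    have "u = - (u * i) * i" using ii by (simp add: mult.assoc)
    then have "u = of_real (- b) * i" using b by simp
    then show ?thesis using u(1) by blast
  qed
  then show ?thesis using complex ii ci by blast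
qed (use real in blast)

text \<open>
  A Hilbert space over \<open>'f\<close>: completeness is provided by the class \<open>banach\<close>, so that bounded
  \<open>'f\<close>-linear operators are elements of the library type \<open>'h \<Rightarrow>\<^sub>L 'h\<close> with its operator norm.
\<close>

locale hilbert_space = vector_space smul
  for smul :: "'f :: real_or_complex \<Rightarrow> 'h :: banach \<Rightarrow> 'h" +
  fixes ip :: "'h \<Rightarrow> 'h \<Rightarrow> 'f"
  assumes scale_of_real: "smul (of_real r) x = r *\<^sub>R x"
    and ip_add_left: "ip (x + y) z = ip x z + ip y z"
    and ip_scale_left: "ip (smul c x) y = c * ip x y"
    and ip_conjugate: "ip y x = conjugate (ip x y)"
    and ip_self: "ip x x = of_real ((norm x)\<^sup>2)"

text \<open>\<open>bounded_ops smul\<close> is \<open>\<B>(H)\<close>.\<close>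

definition bounded_ops :: "('f \<Rightarrow> 'h \<Rightarrow> 'h) \<Rightarrow> ('h :: real_normed_vector \<Rightarrow>\<^sub>L 'h) set" where
  "bounded_ops smul = {T. \<forall>c x. blinfun_apply T (smul c x) = smul c (blinfun_apply T x)}"

definition scale_op :: "('f \<Rightarrow> 'h \<Rightarrow> 'h) \<Rightarrow> 'f \<Rightarrow> ('h :: real_normed_vector \<Rightarrow>\<^sub>L 'h) \<Rightarrow> 'h \<Rightarrow>\<^sub>L 'h" where
  "scale_op smul c T = Blinfun (\<lambda>x. smul c (blinfun_apply T x))"

definition is_adjoint :: "('h \<Rightarrow> 'h \<Rightarrow> 'f) \<Rightarrow> ('h :: real_normed_vector \<Rightarrow>\<^sub>L 'h) \<Rightarrow> ('h \<Rightarrow>\<^sub>L 'h) \<Rightarrow> bool" where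
  "is_adjoint ip S T \<longleftrightarrow> (\<forall>x y. ip (blinfun_apply T x) y = ip x (blinfun_apply S y))"

definition cstar_algebra ::
    "('f \<Rightarrow> 'h \<Rightarrow> 'h) \<Rightarrow> ('h \<Rightarrow> 'h \<Rightarrow> 'f) \<Rightarrow> ('h :: real_normed_vector \<Rightarrow>\<^sub>L 'h) set \<Rightarrow> bool" where
  "cstar_algebra smul ip A \<longleftrightarrow>
     A \<subseteq> bounded_ops smul \<and>
     0 \<in> A \<and>
     (\<forall>S\<in>A. \<forall>T\<in>A. S + T \<in> A) \<and>
     (\<forall>c. \<forall>T\<in>A. scale_op smul c T \<in> A) \<and>
     (\<forall>S\<in>A. \<forall>T\<in>A. S o\<^sub>L T \<in> A) \<and>
     (\<forall>T\<in>A. \<exists>S\<in>A. is_adjoint ip S T) \<and>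
     closed A"

text \<open>The unit of the algebra need not be the identity operator on the Hilbert space.\<close>

definition unital_cstar_algebra ::
    "('f \<Rightarrow> 'h \<Rightarrow> 'h) \<Rightarrow> ('h \<Rightarrow> 'h \<Rightarrow> 'f) \<Rightarrow> ('h :: real_normed_vector \<Rightarrow>\<^sub>L 'h) set \<Rightarrow> bool" where
  "unital_cstar_algebra smul ip A \<longleftrightarrow>
     cstar_algebra smul ip A \<and> (\<exists>U\<in>A. \<forall>T\<in>A. U o\<^sub>L T = T \<and> T o\<^sub>L U = T)"

definition self_adjoints ::
    "('h \<Rightarrow> 'h \<Rightarrow> 'f) \<Rightarrow> ('h :: real_normed_vector \<Rightarrow>\<^sub>L 'h) set \<Rightarrow> ('h \<Rightarrow>\<^sub>L 'h) set" where
  "self_adjoints ip A = {T \<in> A. is_adjoint ip T T}"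

definition projections ::
    "('h \<Rightarrow> 'h \<Rightarrow> 'f) \<Rightarrow> ('h :: real_normed_vector \<Rightarrow>\<^sub>L 'h) set \<Rightarrow> ('h \<Rightarrow>\<^sub>L 'h) set" where
  "projections ip A = {P \<in> self_adjoints ip A. P o\<^sub>L P = P}"

text \<open>Over \<open>\<real>\<close>, self-adjointness does not follow from nonnegativity of the quadratic form.\<close>

definition positive_op ::
    "('h \<Rightarrow> 'h \<Rightarrow> 'f :: real_or_complex) \<Rightarrow> ('h :: real_normed_vector \<Rightarrow>\<^sub>L 'h) \<Rightarrow> bool" where
  "positive_op ip T \<longleftrightarrow> is_adjoint ip T T \<and> (\<forall>x. ip (blinfun_apply T x) x \<in> \<real>\<^sub>\<ge>\<^sub>0)"

definition le_op ::
    "('h \<Rightarrow> 'h \<Rightarrow> 'f :: real_or_complex) \<Rightarrow> ('h :: real_normed_vector \<Rightarrow>\<^sub>L 'h) \<Rightarrow> ('h \<Rightarrow>\<^sub>L 'h) \<Rightarrow> bool" where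
  "le_op ip S T \<longleftrightarrow> positive_op ip (T - S)"

definition is_glb ::
    "('a \<Rightarrow> 'a \<Rightarrow> bool) \<Rightarrow> 'a set \<Rightarrow> 'a \<Rightarrow> 'a \<Rightarrow> 'a \<Rightarrow> bool" where
  "is_glb le X P Q G \<longleftrightarrow>
     G \<in> X \<and> le G P \<and> le G Q \<and> (\<forall>T\<in>X. le T P \<and> le T Q \<longrightarrow> le T G)"

lemma (in hilbert_space) norm_scale: "norm (smul c x) = norm c * norm x"
proof -
  have "ip (smul c x) (smul c x) = c * conjugate c * ip x x"
    by (metis conjugate_mult ip_conjugate ip_scale_left mult.assoc mult.commute)
  then have "(of_real ((norm (smul c x))\<^sup>2) :: 'f) = of_real ((norm c * norm x)\<^sup>2)"
    by (simp add: ip_self mult_conjugate power_mult_distrib scaleR_conv_of_real)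
  then show ?thesis
    unfolding of_real_eq_iff by (simp add: power2_eq_iff_nonneg)
qed

lemma (in hilbert_space) scale_op_apply [simp]:
  "blinfun_apply (scale_op smul c T) x = smul c (blinfun_apply T x)"
proof -
  have "bounded_linear (\<lambda>x. smul c x)"
  proof (rule bounded_linear_intro[where K = "norm c"])
    show "smul c (r *\<^sub>R y) = r *\<^sub>R smul c y" for r y
      by (metis mult.commute scale_of_real scale_scale)
  qed (simp_all add: scale_right_distrib norm_scale mult.commute)
  then have "bounded_linear (\<lambda>x. smul c (blinfun_apply T x))"
    using bounded_linear_compose[OF _ blinfun.bounded_linear_right] by blast
  then show ?thesis
    by (simp add: scale_op_def bounded_linear_Blinfun_apply)
qed

lemma hilbert_space_real:
  "hilbert_space (scaleR :: real \<Rightarrow> 'h \<Rightarrow> 'h) (inner :: 'h :: {real_inner, banach} \<Rightarrow> 'h \<Rightarrow> real)"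
  by unfold_locales
    (auto simp: algebra_simps inner_simps inner_commute conjugate_real_def power2_norm_eq_inner)

lemma hilbert_space_complex: "hilbert_space (*) (\<lambda>x y :: complex. x * cnj y)"
  by unfold_locales
    (auto simp: algebra_simps conjugate_complex_def scaleR_conv_of_real simp flip: complex_norm_square)

end

theory Submission
  imports Defs
begin

text \<open>
  Put \<open>D = P - G\<close> and \<open>E = Q - G\<close>; these are positive with greatest lower bound \<open>0\<close>.
  For every \<open>X\<close> and every real \<open>\<delta>\<close>, the operator
  \<open>\<delta> (D X E + E X\<^sup>* D) - c \<delta>\<^sup>2 (D\<^sup>2 + E\<^sup>2)\<close> is a lower bound of \<open>D\<close> and \<open>E\<close> for a suitable
  constant \<open>c\<close>, hence is \<open>\<le> 0\<close>; letting \<open>\<delta> \<rightarrow> 0\<close> from both sides gives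
  \<open>D X E + E X\<^sup>* D = 0\<close>.  The cases \<open>X = 1\<close> and \<open>X = D E\<close> give \<open>D E = 0\<close>, and then \<open>D X E = 0\<close>
  for all \<open>X\<close> in the algebra.  With \<open>K = P - Q = D - E\<close>, multiplying \<open>P K + K P = K + K\<^sup>2\<close> by \<open>D\<close>
  gives \<open>D P D + D\<^sup>2 P = D\<^sup>2 + D\<^sup>3\<close>, which forces \<open>D\<close> to vanish on the kernel of \<open>P\<close>.
  So \<open>P D = D = D P\<close>, symmetrically \<open>Q E = E = E Q\<close>, and \<open>P Q = P - D + E - E\<^sup>2 = Q P\<close>.
\<close>

section \<open>The underlying real inner product\<close>

context hilbert_space
begin

text \<open>The real part of \<open>ip\<close>, by polarization, since the scalar field has no real-part function.\<close>

definition re_ip :: "'h \<Rightarrow> 'h \<Rightarrow> real" where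
  "re_ip x y = ((norm (x + y))\<^sup>2 - (norm x)\<^sup>2 - (norm y)\<^sup>2) / 2"

lemma ip_add_right: "ip x (y + z) = ip x y + ip x z"
  by (metis conjugate_add ip_add_left ip_conjugate)

text \<open>Transfers identities from \<open>ip\<close> to \<open>re_ip\<close>: prove them for this
  sum over the scalar field, then cancel the injective \<open>of_real\<close>.\<close>

lemma of_real_re_ip: "of_real (2 * re_ip x y) = ip x y + ip y x"
proof -
  have "(of_real ((norm (x + y))\<^sup>2) :: 'f) = ip x x + ip y y + (ip x y + ip y x)"
    by (simp only: ip_self[symmetric] ip_add_left ip_add_right ac_simps)
  then show ?thesis
    by (simp add: re_ip_def ip_self)
qed

lemma ip_scaleR_left: "ip (r *\<^sub>R x) y = of_real r * ip x y"
  by (metis ip_scale_left scale_of_real)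

lemma ip_scaleR_right: "ip x (r *\<^sub>R y) = of_real r * ip x y"
  by (metis conjugate_mult conjugate_of_real ip_conjugate ip_scaleR_left)

lemma ip_diff_left: "ip (x - y) z = ip x z - ip y z"
  using ip_add_left[of "x - y" y z] by simp

lemma ip_diff_right: "ip x (y - z) = ip x y - ip x z"
  using ip_add_right[of x "y - z" z] by simp

lemma re_ip_commute: "re_ip x y = re_ip y x"
  by (simp add: re_ip_def add.commute)

lemma re_ip_add_left: "re_ip (x + y) z = re_ip x z + re_ip y z"
proof -
  have "(of_real (2 * re_ip (x + y) z) :: 'f) = of_real (2 * re_ip x z + 2 * re_ip y z)"
    unfolding of_real_add of_real_re_ip by (simp add: ip_add_left ip_add_right)
  then show ?thesis unfolding of_real_eq_iff by simp
qed

lemma re_ip_scaleR_left: "re_ip (r *\<^sub>R x) z = r * re_ip x z"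
proof -
  have "(of_real (2 * re_ip (r *\<^sub>R x) z) :: 'f) = of_real (r * (2 * re_ip x z))"
    unfolding of_real_mult[of r] of_real_re_ip
    by (simp add: ip_scaleR_left ip_scaleR_right algebra_simps)
  then show ?thesis unfolding of_real_eq_iff by simp
qed

lemma re_ip_diff_left: "re_ip (x - y) z = re_ip x z - re_ip y z"
  using re_ip_add_left[of "x - y" y z] by simp

lemma re_ip_add_right: "re_ip x (y + z) = re_ip x y + re_ip x z"
  by (metis re_ip_add_left re_ip_commute)

lemma re_ip_diff_right: "re_ip x (y - z) = re_ip x y - re_ip x z"
  by (metis re_ip_diff_left re_ip_commute)

lemma re_ip_scaleR_right: "re_ip x (r *\<^sub>R y) = r * re_ip x y"
  by (metis re_ip_scaleR_left re_ip_commute)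

lemmas re_ip_simps = re_ip_add_left re_ip_add_right re_ip_diff_left re_ip_diff_right
  re_ip_scaleR_left re_ip_scaleR_right

lemma re_ip_0 [simp]: "re_ip 0 y = 0"
  by (simp add: re_ip_def)

lemma re_ip_self: "re_ip x x = (norm x)\<^sup>2"
  using of_real_re_ip[of x x] unfolding ip_self of_real_add[symmetric] of_real_eq_iff by simp

text \<open>Cauchy-Schwarz. As \<open>re_ip\<close> is defined by polarization, it is the squared
  triangle inequality rearranged.\<close>

lemma re_ip_le_norm: "re_ip x y \<le> norm x * norm y"
proof -
  have "(norm (x + y))\<^sup>2 \<le> (norm x + norm y)\<^sup>2"
    by (simp add: norm_triangle_ineq power_mono)
  then show ?thesis by (simp add: re_ip_def power2_sum)
qed

lemma abs_re_ip_le_norm: "\<bar>re_ip x y\<bar> \<le> norm x * norm y"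
  using re_ip_le_norm[of x y] re_ip_le_norm[of "- x" y] re_ip_scaleR_left[of "-1" x y]
  by (simp add: abs_le_iff)

section \<open>Adjoints, positive operators and their quadratic forms\<close>

lemma is_adjoint_sym: "is_adjoint ip S T \<Longrightarrow> is_adjoint ip T S"
  unfolding is_adjoint_def by (metis ip_conjugate)

lemma is_adjoint_re_ip: "is_adjoint ip S T \<Longrightarrow> re_ip (blinfun_apply T x) y = re_ip x (blinfun_apply S y)"
proof -
  assume a: "is_adjoint ip S T"
  have "(of_real (2 * re_ip (blinfun_apply T x) y) :: 'f) = of_real (2 * re_ip x (blinfun_apply S y))"
    unfolding of_real_re_ip using a is_adjoint_sym[OF a] by (simp add: is_adjoint_def)
  then show ?thesis unfolding of_real_eq_iff by simp
qed

lemma is_adjoint_add: "is_adjoint ip S T \<Longrightarrow> is_adjoint ip S' T' \<Longrightarrow> is_adjoint ip (S + S') (T + T')"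
  by (simp add: is_adjoint_def plus_blinfun.rep_eq ip_add_left ip_add_right)

lemma is_adjoint_diff: "is_adjoint ip S T \<Longrightarrow> is_adjoint ip S' T' \<Longrightarrow> is_adjoint ip (S - S') (T - T')"
  by (simp add: is_adjoint_def minus_blinfun.rep_eq ip_diff_left ip_diff_right)

lemma is_adjoint_scaleR: "is_adjoint ip S T \<Longrightarrow> is_adjoint ip (r *\<^sub>R S) (r *\<^sub>R T)"
  by (simp add: is_adjoint_def scaleR_blinfun.rep_eq ip_scaleR_left ip_scaleR_right)

lemma is_adjoint_compose:
  "is_adjoint ip S T \<Longrightarrow> is_adjoint ip S' T' \<Longrightarrow> is_adjoint ip (S' o\<^sub>L S) (T o\<^sub>L T')"
  by (simp add: is_adjoint_def)

text \<open>Self-adjointness makes the form values equal to their own conjugates, so they coincide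
  with their real parts.\<close>

lemma positive_op_re_ip:
  assumes "is_adjoint ip T T"
  shows "positive_op ip T \<longleftrightarrow> (\<forall>x. 0 \<le> re_ip (blinfun_apply T x) x)"
proof -
  have "ip (blinfun_apply T x) x = of_real (re_ip (blinfun_apply T x) x)" for x
  proof -
    have "2 * (of_real (re_ip (blinfun_apply T x) x) :: 'f) = 2 * ip (blinfun_apply T x) x"
      using of_real_re_ip[of "blinfun_apply T x" x] assms by (simp add: is_adjoint_def)
    then show ?thesis by (metis mult_left_cancel zero_neq_numeral)
  qed
  then show ?thesis
    using assms by (auto simp: positive_op_def nonneg_Reals_def)
qed

text \<open>This is \<open>D\<^sup>2 \<le> norm D *\<^sub>R D\<close> in terms of forms, obtained
  without square roots by evaluating the form of \<open>D\<close> at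
  \<open>v - t D v\<close>.\<close>

lemma positive_op_norm_le:
  assumes "positive_op ip D"
  shows "(norm (blinfun_apply D v))\<^sup>2 \<le> norm D * re_ip (blinfun_apply D v) v"
proof (cases "D = 0")
  case False
  \<comment> \<open>With \<open>t = 1 / norm D\<close> the quadratic term is at most
    \<open>t * n\<close>, half of the linear term \<open>2 * t * n\<close>, which leaves
    \<open>t * n \<le> re_ip (D v) v\<close>.\<close>
  let ?n = "(norm (blinfun_apply D v))\<^sup>2" and ?t = "1 / norm D"
  have D: "is_adjoint ip D D" using assms by (simp add: positive_op_def)
  have nD: "norm D > 0" using False by simp
  define y where "y = blinfun_apply D v"
  have "0 \<le> re_ip (blinfun_apply D (v - ?t *\<^sub>R y)) (v - ?t *\<^sub>R y)"
    using assms positive_op_re_ip[OF D] by blast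
  also have "\<dots> = re_ip y v - ?t * re_ip y y - ?t * re_ip (blinfun_apply D y) v
      + ?t\<^sup>2 * re_ip (blinfun_apply D y) y"
    by (simp add: blinfun.diff_right blinfun.scaleR_right re_ip_simps y_def[symmetric]
        power2_eq_square algebra_simps)
  also have "re_ip (blinfun_apply D y) v = ?n"
    using is_adjoint_re_ip[OF D, of y v] by (simp add: re_ip_self y_def)
  also have "re_ip y y = ?n" by (simp add: re_ip_self y_def)
  finally have 1: "0 \<le> re_ip y v - 2 * ?t * ?n + ?t\<^sup>2 * re_ip (blinfun_apply D y) y"
    by simp
  have "re_ip (blinfun_apply D y) y \<le> norm (blinfun_apply D y) * norm y"
    by (rule re_ip_le_norm)
  also have "\<dots> \<le> norm D * norm y * norm y"
    by (intro mult_right_mono norm_blinfun) simp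
  finally have "?t\<^sup>2 * re_ip (blinfun_apply D y) y \<le> ?t\<^sup>2 * (norm D * norm y * norm y)"
    by (intro mult_left_mono) auto
  also have "\<dots> = ?t * ?n" using nD by (simp add: y_def power2_eq_square)
  finally have "?t * ?n \<le> re_ip y v" using 1 by simp
  then show ?thesis using nD by (simp add: y_def field_simps)
qed simp

lemma positive_op_eq_0:
  assumes "positive_op ip D" "re_ip (blinfun_apply D v) v \<le> 0"
  shows "blinfun_apply D v = 0"
proof -
  have "(norm (blinfun_apply D v))\<^sup>2 \<le> 0"
    using positive_op_norm_le[OF assms(1), of v] assms(2)
    by (meson mult_nonneg_nonpos norm_ge_zero order_trans)
  then show ?thesis by simp
qed

lemma self_adjoint_apply_twice_eq_0:
  assumes "is_adjoint ip D D" "blinfun_apply D (blinfun_apply D v) = 0"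
  shows "blinfun_apply D v = 0"
  using is_adjoint_re_ip[OF assms(1), of "blinfun_apply D v" v] assms(2) by (simp add: re_ip_self)

text \<open>Polarization at \<open>v + W v\<close>: the cross terms add up to
  \<open>2 * norm (W v)\<^sup>2\<close>. Self-adjointness matters, since a real skew operator also
  has zero form.\<close>

lemma self_adjoint_eq_0:
  assumes "is_adjoint ip W W" "\<And>v. re_ip (blinfun_apply W v) v = 0"
  shows "W = 0"
proof (rule blinfun_eqI)
  fix v
  let ?w = "blinfun_apply W v"
  have "0 = re_ip (blinfun_apply W (v + ?w)) (v + ?w)" using assms(2) by simp
  also have "\<dots> = re_ip ?w ?w + re_ip (blinfun_apply W ?w) v"
    using assms(2)[of v] assms(2)[of ?w] by (simp add: blinfun.add_right re_ip_simps)
  also have "\<dots> = 2 * (norm ?w)\<^sup>2"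
    using is_adjoint_re_ip[OF assms(1), of ?w v] by (simp add: re_ip_self)
  finally show "blinfun_apply W v = blinfun_apply 0 v" by simp
qed

section \<open>Closure of the algebra, and translation of the greatest lower bound to 0\<close>

lemma cstar_algebra_add: "cstar_algebra smul ip A \<Longrightarrow> S \<in> A \<Longrightarrow> T \<in> A \<Longrightarrow> S + T \<in> A"
  by (simp add: cstar_algebra_def)

lemma cstar_algebra_compose: "cstar_algebra smul ip A \<Longrightarrow> S \<in> A \<Longrightarrow> T \<in> A \<Longrightarrow> S o\<^sub>L T \<in> A"
  by (simp add: cstar_algebra_def)

lemma cstar_algebra_scaleR:
  assumes "cstar_algebra smul ip A" "T \<in> A"
  shows "r *\<^sub>R T \<in> A"
proof -
  have "scale_op smul (of_real r) T = r *\<^sub>R T"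
    by (rule blinfun_eqI) (simp add: scale_of_real scaleR_blinfun.rep_eq)
  then show ?thesis using assms unfolding cstar_algebra_def by metis
qed

lemma cstar_algebra_diff:
  assumes "cstar_algebra smul ip A" "S \<in> A" "T \<in> A"
  shows "S - T \<in> A"
proof -
  have "S + (-1) *\<^sub>R T \<in> A"
    using assms cstar_algebra_scaleR[OF assms(1,3), of "-1"] unfolding cstar_algebra_def by blast
  then show ?thesis by simp
qed

text \<open>The order depends only on differences, so adding \<open>G\<close> turns a lower bound of
  the translated pair into one of \<open>P\<close> and \<open>Q\<close>.\<close>

lemma is_glb_translate:
  assumes A: "cstar_algebra smul ip A"
    and G: "is_glb (le_op ip) (self_adjoints ip A) P Q G"
  shows "is_glb (le_op ip) (self_adjoints ip A) (P - G) (Q - G) 0"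
proof -
  have Gs: "G \<in> self_adjoints ip A" using G by (simp add: is_glb_def)
  have "0 \<in> self_adjoints ip A"
    using A Gs is_adjoint_diff[of G G G G] by (auto simp: self_adjoints_def cstar_algebra_def)
  moreover have "le_op ip T 0"
    if T: "T \<in> self_adjoints ip A" "le_op ip T (P - G)" "le_op ip T (Q - G)" for T
  proof -
    have "T + G \<in> self_adjoints ip A"
      using T(1) Gs A is_adjoint_add by (auto simp: self_adjoints_def cstar_algebra_def)
    moreover have "P - (T + G) = P - G - T" "Q - (T + G) = Q - G - T" by simp_all
    ultimately have "le_op ip (T + G) G"
      using G T(2,3) unfolding is_glb_def le_op_def by metis
    then show ?thesis by (simp add: le_op_def)
  qed
  ultimately show ?thesis using G by (simp add: is_glb_def le_op_def)
qed

section \<open>Products of two positive elements with greatest lower bound 0\<close>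

text \<open>Membership in \<open>A\<close> is asked of the symmetrized product rather than of
  \<open>X\<close>, so that \<open>X\<close> can be the identity operator of the Hilbert space,
  which may differ from the unit of \<open>A\<close>.\<close>

lemma glb_0_symmetrized_product_eq_0:
  assumes A: "cstar_algebra smul ip A"
    and glb: "is_glb (le_op ip) (self_adjoints ip A) D E 0"
    and D: "D \<in> A" and E: "E \<in> A"
    and XY: "is_adjoint ip Y X"
    and W: "(D o\<^sub>L X o\<^sub>L E) + (E o\<^sub>L Y o\<^sub>L D) \<in> A"
  shows "(D o\<^sub>L X o\<^sub>L E) + (E o\<^sub>L Y o\<^sub>L D) = 0"
proof -
  define W where "W = (D o\<^sub>L X o\<^sub>L E) + (E o\<^sub>L Y o\<^sub>L D)"
  define S where "S = (D o\<^sub>L D) + (E o\<^sub>L E)"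
  have pD: "positive_op ip D" and pE: "positive_op ip E"
    using glb by (auto simp: is_glb_def le_op_def)
  then have aD: "is_adjoint ip D D" and aE: "is_adjoint ip E E" by (auto simp: positive_op_def)
  have aW: "is_adjoint ip W W"
  proof -
    have "is_adjoint ip (E o\<^sub>L (Y o\<^sub>L D)) (D o\<^sub>L X o\<^sub>L E)"
      by (intro is_adjoint_compose aD aE XY)
    moreover have "is_adjoint ip (D o\<^sub>L (X o\<^sub>L E)) (E o\<^sub>L Y o\<^sub>L D)"
      by (intro is_adjoint_compose aD aE is_adjoint_sym[OF XY])
    ultimately have "is_adjoint ip ((E o\<^sub>L (Y o\<^sub>L D)) + (D o\<^sub>L (X o\<^sub>L E))) W"
      unfolding W_def by (rule is_adjoint_add)
    moreover have "(E o\<^sub>L (Y o\<^sub>L D)) + (D o\<^sub>L (X o\<^sub>L E)) = W"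
      by (rule blinfun_eqI) (simp add: W_def plus_blinfun.rep_eq)
    ultimately show ?thesis by simp
  qed
  have aS: "is_adjoint ip S S"
    unfolding S_def by (intro is_adjoint_add is_adjoint_compose aD aE)
  have SA: "S \<in> A"
    unfolding S_def by (intro cstar_algebra_add[OF A] cstar_algebra_compose[OF A] D E)
  \<comment> \<open>A common bound for both norms; the summand 1 keeps it positive even if
    \<open>D\<close> and \<open>E\<close> vanish.\<close>
  define k where "k = norm D + norm E + 1"
  have k: "k > 0" by (simp add: k_def add_nonneg_pos)
  \<comment> \<open>Chosen so that \<open>k * c * \<delta>\<^sup>2 * b\<^sup>2\<close> is the square
    of \<open>k * \<bar>\<delta>\<bar> * norm X * b\<close>, as completing the square
    requires.\<close>
  define c where "c = k * (norm X)\<^sup>2"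
  have Wv: "re_ip (blinfun_apply W v) v = 2 * re_ip (blinfun_apply X (blinfun_apply E v)) (blinfun_apply D v)" for v
    using is_adjoint_re_ip[OF aD, of "blinfun_apply X (blinfun_apply E v)" v]
      is_adjoint_re_ip[OF aE, of "blinfun_apply Y (blinfun_apply D v)" v]
      is_adjoint_re_ip[OF is_adjoint_sym[OF XY], of "blinfun_apply D v" "blinfun_apply E v"]
      re_ip_commute[of "blinfun_apply D v" "blinfun_apply X (blinfun_apply E v)"]
    by (simp add: W_def plus_blinfun.rep_eq re_ip_simps)
  have Sv: "re_ip (blinfun_apply S v) v = (norm (blinfun_apply D v))\<^sup>2 + (norm (blinfun_apply E v))\<^sup>2" for v
    using is_adjoint_re_ip[OF aD, of "blinfun_apply D v" v] is_adjoint_re_ip[OF aE, of "blinfun_apply E v" v]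
    by (simp add: S_def plus_blinfun.rep_eq re_ip_simps re_ip_self)
  \<comment> \<open>Here \<open>d\<close> stands for the form of \<open>D\<close> or of
    \<open>E\<close> at \<open>v\<close>; the disjunction lets one estimate serve both lower
    bounds.\<close>
  have bound: "\<delta> * re_ip (blinfun_apply W v) v \<le> d + c * \<delta>\<^sup>2 * re_ip (blinfun_apply S v) v"
    if "(norm (blinfun_apply D v))\<^sup>2 \<le> k * d \<or> (norm (blinfun_apply E v))\<^sup>2 \<le> k * d" for v \<delta> d
  proof -
    let ?a = "norm (blinfun_apply D v)" and ?b = "norm (blinfun_apply E v)" and ?x = "norm X"
    let ?r = "re_ip (blinfun_apply X (blinfun_apply E v)) (blinfun_apply D v)"
    have "\<bar>?r\<bar> \<le> norm (blinfun_apply X (blinfun_apply E v)) * ?a"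
      by (rule abs_re_ip_le_norm)
    also have "\<dots> \<le> ?x * ?b * ?a" by (intro mult_right_mono norm_blinfun) simp
    finally have "\<bar>\<delta>\<bar> * \<bar>?r\<bar> \<le> \<bar>\<delta>\<bar> * (?x * ?b * ?a)" by (intro mult_left_mono) auto
    then have "\<delta> * ?r \<le> \<bar>\<delta>\<bar> * ?x * ?b * ?a"
      using abs_ge_self[of "\<delta> * ?r"] by (simp add: abs_mult mult.assoc)
    then have le: "k * (\<delta> * re_ip (blinfun_apply W v) v) \<le> k * (2 * \<bar>\<delta>\<bar> * ?x * ?b * ?a)"
      unfolding Wv using k by (intro mult_left_mono) auto
    have "k * (2 * \<bar>\<delta>\<bar> * ?x * ?b * ?a) \<le> k * d + k * (c * \<delta>\<^sup>2 * (?a\<^sup>2 + ?b\<^sup>2))"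
      using that
    proof
      assume h: "?a\<^sup>2 \<le> k * d"
      \<comment> \<open>The norm whose square is controlled by \<open>k * d\<close> stands alone in
        the square; the other one is absorbed by the \<open>S\<close> term.\<close>
      have "0 \<le> (?a - k * \<bar>\<delta>\<bar> * ?x * ?b)\<^sup>2" by simp
      then have "k * (2 * \<bar>\<delta>\<bar> * ?x * ?b * ?a) \<le> ?a\<^sup>2 + k * (c * \<delta>\<^sup>2 * ?b\<^sup>2)"
        by (simp add: c_def power2_diff power2_eq_square[of k] algebra_simps)
      moreover have "0 \<le> k * (c * \<delta>\<^sup>2 * ?a\<^sup>2)" using k by (simp add: c_def)
      ultimately show ?thesis using h by (simp add: algebra_simps)
    next
      assume h: "?b\<^sup>2 \<le> k * d"
      have "0 \<le> (?b - k * \<bar>\<delta>\<bar> * ?x * ?a)\<^sup>2" by simp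
      then have "k * (2 * \<bar>\<delta>\<bar> * ?x * ?b * ?a) \<le> ?b\<^sup>2 + k * (c * \<delta>\<^sup>2 * ?a\<^sup>2)"
        by (simp add: c_def power2_diff power2_eq_square[of k] algebra_simps)
      moreover have "0 \<le> k * (c * \<delta>\<^sup>2 * ?b\<^sup>2)" using k by (simp add: c_def)
      ultimately show ?thesis using h by (simp add: algebra_simps)
    qed
    with le have "k * (\<delta> * re_ip (blinfun_apply W v) v) \<le> k * (d + c * \<delta>\<^sup>2 * (?a\<^sup>2 + ?b\<^sup>2))"
      by (simp add: algebra_simps)
    then show ?thesis unfolding Sv using k by simp
  qed
  have nonpos: "\<delta> * re_ip (blinfun_apply W v) v \<le> c * \<delta>\<^sup>2 * re_ip (blinfun_apply S v) v" for \<delta> v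
  proof -
    \<comment> \<open>The first-order term in \<delta> is arbitrary in sign; the second-order
      correction by \<open>S\<close> is what brings \<open>T\<close> below both \<open>D\<close> and
      \<open>E\<close>.\<close>
    define T where "T = \<delta> *\<^sub>R W - (c * \<delta>\<^sup>2) *\<^sub>R S"
    have aT: "is_adjoint ip T T"
      unfolding T_def by (intro is_adjoint_diff is_adjoint_scaleR aW aS)
    have "T \<in> A"
      unfolding T_def using W SA
      by (intro cstar_algebra_diff[OF A] cstar_algebra_scaleR[OF A]) (auto simp: W_def)
    then have TA: "T \<in> self_adjoints ip A" using aT by (simp add: self_adjoints_def)
    have Tv: "re_ip (blinfun_apply T v) v
        = \<delta> * re_ip (blinfun_apply W v) v - c * \<delta>\<^sup>2 * re_ip (blinfun_apply S v) v" for v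
      by (simp add: T_def minus_blinfun.rep_eq scaleR_blinfun.rep_eq re_ip_simps)
    have le: "le_op ip T M" if M: "positive_op ip M" "M = D \<or> M = E" for M
    proof -
      have aM: "is_adjoint ip M M" using M by (simp add: positive_op_def)
      have "re_ip (blinfun_apply T v) v \<le> re_ip (blinfun_apply M v) v" for v
      proof -
        have "0 \<le> re_ip (blinfun_apply M v) v" using M positive_op_re_ip[OF aM] by blast
        then have "norm M * re_ip (blinfun_apply M v) v \<le> k * re_ip (blinfun_apply M v) v"
          using M(2) by (intro mult_right_mono) (auto simp: k_def)
        with positive_op_norm_le[OF M(1), of v]
        have "(norm (blinfun_apply M v))\<^sup>2 \<le> k * re_ip (blinfun_apply M v) v" by linarith
        then show ?thesis
          using bound[of v "re_ip (blinfun_apply M v) v" \<delta>] M(2) unfolding Tv by fastforce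
      qed
      then show ?thesis
        unfolding le_op_def positive_op_re_ip[OF is_adjoint_diff[OF aM aT]]
        by (simp add: minus_blinfun.rep_eq re_ip_simps)
    qed
    have "le_op ip T 0"
      using glb TA le[OF pD] le[OF pE] by (simp add: is_glb_def)
    then have p: "positive_op ip (0 - T)" by (simp add: le_op_def)
    then have "is_adjoint ip (0 - T) (0 - T)" by (simp add: positive_op_def)
    then have "0 \<le> re_ip (blinfun_apply (0 - T) v) v" using p positive_op_re_ip by blast
    then have "re_ip (blinfun_apply T v) v \<le> 0"
      by (simp only: minus_blinfun.rep_eq re_ip_diff_left) simp
    then show ?thesis unfolding Tv by simp
  qed
  have "re_ip (blinfun_apply W v) v = 0" for v
  proof -
    define w where "w = re_ip (blinfun_apply W v) v"
    define s where "s = c * re_ip (blinfun_apply S v) v"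
    have s: "0 \<le> s" using k by (simp add: s_def c_def Sv)
    \<comment> \<open>In place of a limit: \<open>\<delta> * w \<le> s * \<delta>\<^sup>2\<close>
      holds for every \<delta>, and \<open>\<delta> = w / (s + 1)\<close> already forces
      \<open>w = 0\<close>. The 1 guards against \<open>s = 0\<close>.\<close>
    have "w / (s + 1) * w \<le> s * (w / (s + 1))\<^sup>2"
      using nonpos[of "w / (s + 1)" v] by (simp add: w_def[symmetric] s_def mult_ac)
    then have "w / (s + 1) * w * (s + 1)\<^sup>2 \<le> s * (w / (s + 1))\<^sup>2 * (s + 1)\<^sup>2"
      by (rule mult_right_mono) simp
    then have "w\<^sup>2 * (s + 1) \<le> s * w\<^sup>2"
      using s by (simp add: power2_eq_square)
    then have "w\<^sup>2 \<le> 0" by (simp add: algebra_simps)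
    then show ?thesis by (simp add: w_def)
  qed
  then have "W = 0" by (rule self_adjoint_eq_0[OF aW])
  then show ?thesis by (simp add: W_def)
qed

lemma glb_0_orthogonal:
  assumes A: "cstar_algebra smul ip A"
    and glb: "is_glb (le_op ip) (self_adjoints ip A) D E 0"
    and D: "D \<in> A" and E: "E \<in> A"
  shows "blinfun_apply E (blinfun_apply D x) = 0" "blinfun_apply D (blinfun_apply E x) = 0"
proof -
  let ?D = "blinfun_apply D" and ?E = "blinfun_apply E"
  have aD: "is_adjoint ip D D" and aE: "is_adjoint ip E E"
    using glb by (auto simp: is_glb_def le_op_def positive_op_def)
  have "is_adjoint ip id_blinfun id_blinfun" by (simp add: is_adjoint_def)
  moreover have "(D o\<^sub>L id_blinfun o\<^sub>L E) + (E o\<^sub>L id_blinfun o\<^sub>L D) = (D o\<^sub>L E) + (E o\<^sub>L D)"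
    by (rule blinfun_eqI) (simp add: plus_blinfun.rep_eq)
  moreover have "(D o\<^sub>L E) + (E o\<^sub>L D) \<in> A"
    by (intro cstar_algebra_add[OF A] cstar_algebra_compose[OF A] D E)
  ultimately have "(D o\<^sub>L E) + (E o\<^sub>L D) = 0"
    using glb_0_symmetrized_product_eq_0[OF A glb D E, of id_blinfun id_blinfun] by simp
  then have "?E (?D y) + ?D (?E y) = 0" for y
    by (metis add.commute blinfun_apply_blinfun_compose plus_blinfun.rep_eq zero_blinfun.rep_eq)
  then have anti: "?E (?D y) = - ?D (?E y)" for y
    unfolding eq_neg_iff_add_eq_0 .
  \<comment> \<open>Two sign changes cancel: as \<open>D\<close> and \<open>E\<close> anticommute,
    \<open>E\<^sup>2\<close> commutes with \<open>D\<close>.\<close>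
  have comm: "?E (?E (?D y)) = ?D (?E (?E y))" for y
    by (simp only: anti blinfun.minus_right minus_minus)
  have "is_adjoint ip (E o\<^sub>L D) (D o\<^sub>L E)" by (intro is_adjoint_compose aD aE)
  moreover have "(D o\<^sub>L (D o\<^sub>L E) o\<^sub>L E) + (E o\<^sub>L (E o\<^sub>L D) o\<^sub>L D) \<in> A"
    by (intro cstar_algebra_add[OF A] cstar_algebra_compose[OF A] D E)
  ultimately have "(D o\<^sub>L (D o\<^sub>L E) o\<^sub>L E) + (E o\<^sub>L (E o\<^sub>L D) o\<^sub>L D) = 0"
    using glb_0_symmetrized_product_eq_0[OF A glb D E] by blast
  then have "blinfun_apply ((D o\<^sub>L (D o\<^sub>L E) o\<^sub>L E) + (E o\<^sub>L (E o\<^sub>L D) o\<^sub>L D)) x = 0" by simp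
  then have "?D (?D (?E (?E x))) + ?E (?E (?D (?D x))) = 0" by (simp add: plus_blinfun.rep_eq)
  \<comment> \<open>By this commutation both summands equal \<open>D E\<^sup>2 D\<close>, which is
    the product of \<open>E D\<close> with its adjoint; so \<open>E D = 0\<close>.\<close>
  then have "2 *\<^sub>R ?D (?D (?E (?E x))) = 0"
    by (simp only: comm scaleR_2)
  then have "?D (?E (?E (?D x))) = 0"
    by (simp add: comm)
  then have "re_ip (?E (?D x)) (?E (?D x)) = 0"
    using is_adjoint_re_ip[OF aD, of "?E (?E (?D x))" x] is_adjoint_re_ip[OF aE, of "?E (?D x)" "?D x"]
    by simp
  then show "?E (?D x) = 0" by (simp add: re_ip_self)
  then show "?D (?E x) = 0" using anti[of x] by simp
qed

text \<open>Since \<open>D X E = - E Y D\<close> and \<open>D E = 0\<close>, a further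
  \<open>D\<close> on the left gives \<open>D\<^sup>2 X E = 0\<close>, and a self-adjoint
  \<open>D\<close> has the same kernel as its square.\<close>

lemma glb_0_sandwich:
  assumes A: "cstar_algebra smul ip A"
    and glb: "is_glb (le_op ip) (self_adjoints ip A) D E 0"
    and D: "D \<in> A" and E: "E \<in> A" and X: "X \<in> A"
  shows "blinfun_apply D (blinfun_apply X (blinfun_apply E v)) = 0"
proof -
  have aD: "is_adjoint ip D D"
    using glb by (auto simp: is_glb_def le_op_def positive_op_def)
  obtain Y where Y: "Y \<in> A" "is_adjoint ip Y X" using A X unfolding cstar_algebra_def by blast
  have "(D o\<^sub>L X o\<^sub>L E) + (E o\<^sub>L Y o\<^sub>L D) \<in> A"
    by (intro cstar_algebra_add[OF A] cstar_algebra_compose[OF A] D E X Y(1))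
  then have "blinfun_apply ((D o\<^sub>L X o\<^sub>L E) + (E o\<^sub>L Y o\<^sub>L D)) v = 0"
    using glb_0_symmetrized_product_eq_0[OF A glb D E Y(2)] by simp
  then have "blinfun_apply D (blinfun_apply X (blinfun_apply E v))
      = - blinfun_apply E (blinfun_apply Y (blinfun_apply D v))"
    by (simp add: plus_blinfun.rep_eq eq_neg_iff_add_eq_0)
  then have "blinfun_apply D (blinfun_apply D (blinfun_apply X (blinfun_apply E v))) = 0"
    using glb_0_orthogonal(2)[OF A glb D E] by (simp add: blinfun.minus_right)
  then show ?thesis by (rule self_adjoint_apply_twice_eq_0[OF aD])
qed

section \<open>Absorption by the projections, and commutation\<close>

text \<open>Stated apart from the lower bound so that it applies both to \<open>P\<close>,
  \<open>D\<close> and, with the roles exchanged, to \<open>Q\<close>, \<open>E\<close>.\<close>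

lemma orthogonal_part_absorbed:
  fixes P Q D E :: "'h \<Rightarrow>\<^sub>L 'h"
  assumes P: "is_adjoint ip P P" "P o\<^sub>L P = P" and Q: "Q o\<^sub>L Q = Q"
    and D: "positive_op ip D" and eq: "P - Q = D - E"
    and DE: "\<And>x. blinfun_apply D (blinfun_apply E x) = 0"
    and DPE: "\<And>x. blinfun_apply D (blinfun_apply P (blinfun_apply E x)) = 0"
  shows "blinfun_apply D (blinfun_apply P x) = blinfun_apply D x"
    and "blinfun_apply P (blinfun_apply D x) = blinfun_apply D x"
proof -
  let ?D = "blinfun_apply D" and ?E = "blinfun_apply E"
  let ?P = "blinfun_apply P" and ?Q = "blinfun_apply Q"
  note lin = blinfun.diff_right blinfun.add_right
  have aD: "is_adjoint ip D D" using D by (simp add: positive_op_def)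
  have PP: "?P (?P x) = ?P x" for x using P(2) by (metis blinfun_apply_blinfun_compose)
  have QQ: "?Q (?Q x) = ?Q x" for x using Q by (metis blinfun_apply_blinfun_compose)
  have K: "?P x - ?Q x = ?D x - ?E x" for x using eq by (metis minus_blinfun.rep_eq)
  show DP: "?D (?P x) = ?D x" for x
  proof -
    \<comment> \<open>An arbitrary vector of the kernel of \<open>P\<close>; the goal is
      \<open>D y = 0\<close>.\<close>
    define y where "y = x - ?P x"
    have Py: "?P y = 0" by (simp add: y_def lin PP)
    define k where "k = ?D y - ?E y"
    have k: "k = - ?Q y" using K[of y] Py by (simp add: k_def)
    \<comment> \<open>On the kernel of \<open>P\<close>, the difference \<open>P - Q\<close> is
      \<open>- Q\<close>, so \<open>k\<close> is fixed by \<open>Q\<close>, and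
      \<open>P = Q + (P - Q)\<close> is applied to it.\<close>
    have "?P k = k + (?P k - ?Q k)" by (simp add: k blinfun.minus_right QQ)
    then have "?P k = k + (?D k - ?E k)" using K by simp
    then have "?D (?P k) = ?D k + ?D (?D k)" by (simp add: lin DE)
    then have e: "?D (?P (?D y)) = ?D (?D y) + ?D (?D (?D y))"
      by (simp add: k_def lin DE DPE)
    define z where "z = ?D y"
    \<comment> \<open>Pairing \<open>e\<close> with \<open>y\<close> turns it into an identity of
      norms; as a projection is contractive, the form of \<open>D\<close> at \<open>z\<close> cannot
      be positive.\<close>
    have "(norm (?P z))\<^sup>2 = re_ip (?D (?P z)) y"
      using is_adjoint_re_ip[OF aD, of "?P z" y] is_adjoint_re_ip[OF P(1), of "?P z" z]
      by (simp add: z_def PP re_ip_self)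
    also have "\<dots> = re_ip z z + re_ip (?D z) z"
      using e is_adjoint_re_ip[OF aD, of z y] is_adjoint_re_ip[OF aD, of "?D z" y]
      by (simp add: z_def re_ip_simps)
    finally have 1: "(norm (?P z))\<^sup>2 = (norm z)\<^sup>2 + re_ip (?D z) z" by (simp add: re_ip_self)
    have "(norm (?P z))\<^sup>2 = re_ip (?P z) z"
      using is_adjoint_re_ip[OF P(1), of "?P z" z] by (simp add: PP re_ip_self)
    also have "\<dots> \<le> norm (?P z) * norm z" by (rule re_ip_le_norm)
    finally have "norm (?P z) \<le> norm z"
      by (cases "?P z = 0") (simp_all add: power2_eq_square)
    then have "(norm (?P z))\<^sup>2 \<le> (norm z)\<^sup>2" by (simp add: power_mono)
    with 1 have "re_ip (?D z) z \<le> 0" by simp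
    then have "?D z = 0" by (rule positive_op_eq_0[OF D])
    then have "?D y = 0" using self_adjoint_apply_twice_eq_0[OF aD] by (simp add: z_def)
    then show ?thesis by (simp add: y_def lin)
  qed
  show "?P (?D x) = ?D x"
  proof -
    let ?w = "?P (?D x) - ?D x"
    \<comment> \<open>Taking adjoints of \<open>D P = D\<close>, tested against every
      \<open>u\<close>.\<close>
    have "re_ip ?w u = 0" for u
      using is_adjoint_re_ip[OF P(1), of "?D x" u] is_adjoint_re_ip[OF aD, of x u]
        is_adjoint_re_ip[OF aD, of x "?P u"]
      by (simp add: re_ip_simps DP)
    then have "re_ip ?w ?w = 0" by blast
    then show ?thesis by (simp add: re_ip_self)
  qed
qed

lemma projections_glb_commute:
  assumes A: "cstar_algebra smul ip A"
    and P: "P \<in> projections ip A" and Q: "Q \<in> projections ip A"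
    and G: "is_glb (le_op ip) (self_adjoints ip A) P Q G"
  shows "P o\<^sub>L Q = Q o\<^sub>L P"
proof (rule blinfun_eqI)
  fix x
  define D where "D = P - G"
  define E where "E = Q - G"
  let ?D = "blinfun_apply D" and ?E = "blinfun_apply E"
  let ?P = "blinfun_apply P" and ?Q = "blinfun_apply Q"
  have PA: "P \<in> A" "is_adjoint ip P P" "P o\<^sub>L P = P"
    using P by (auto simp: projections_def self_adjoints_def)
  have QA: "Q \<in> A" "is_adjoint ip Q Q" "Q o\<^sub>L Q = Q"
    using Q by (auto simp: projections_def self_adjoints_def)
  have "G \<in> A" using G by (simp add: is_glb_def self_adjoints_def)
  then have D: "D \<in> A" and E: "E \<in> A"
    using PA QA cstar_algebra_diff[OF A] by (auto simp: D_def E_def)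
  have pos: "positive_op ip D" "positive_op ip E"
    using G by (auto simp: is_glb_def le_op_def D_def E_def)
  have glb: "is_glb (le_op ip) (self_adjoints ip A) D E 0"
    using is_glb_translate[OF A G] by (simp add: D_def E_def)
  then have glb': "is_glb (le_op ip) (self_adjoints ip A) E D 0"
    by (auto simp: is_glb_def)
  note ED = glb_0_orthogonal[OF A glb D E]
  have eq: "P - Q = D - E" "Q - P = E - D" by (simp_all add: D_def E_def)
  note PD = orthogonal_part_absorbed[OF PA(2,3) QA(3) pos(1) eq(1) ED(2)
      glb_0_sandwich[OF A glb D E PA(1)]]
  note QE = orthogonal_part_absorbed[OF QA(2,3) PA(3) pos(2) eq(2) ED(1)
      glb_0_sandwich[OF A glb' E D QA(1)]]
  have PP: "?P (?P x) = ?P x" for x using PA(3) by (metis blinfun_apply_blinfun_compose)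
  have p: "?P y = ?Q y + ?D y - ?E y" and q: "?Q y = ?P y - ?D y + ?E y" for y
    by (simp_all add: D_def E_def minus_blinfun.rep_eq)
  \<comment> \<open>Composing \<open>P = Q + D - E\<close> with \<open>E\<close> on either side
    gives the same \<open>E - E\<^sup>2\<close>; this symmetry is what makes \<open>P\<close> and
    \<open>Q\<close> commute.\<close>
  have PE: "?P (?E x) = ?E x - ?E (?E x)"
    using p[of "?E x"] by (simp add: QE ED)
  have EP: "?E (?P x) = ?E x - ?E (?E x)"
    using arg_cong[OF p[of x], of ?E] by (simp add: blinfun.diff_right blinfun.add_right QE ED)
  have "?P (?Q x) = ?P x - ?D x + ?P (?E x)"
    by (subst q) (simp add: blinfun.diff_right blinfun.add_right PP PD)
  also have "\<dots> = ?Q (?P x)"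
    using q[of "?P x"] by (simp add: PP PD PE EP)
  finally show "blinfun_apply (P o\<^sub>L Q) x = blinfun_apply (Q o\<^sub>L P) x" by simp
qed

end

theorem corollary7p2:
  fixes smul :: "'f :: real_or_complex \<Rightarrow> 'h :: banach \<Rightarrow> 'h"
    and ip :: "'h \<Rightarrow> 'h \<Rightarrow> 'f"
    and A :: "('h \<Rightarrow>\<^sub>L 'h) set"
    and P Q :: "'h \<Rightarrow>\<^sub>L 'h"
  assumes "hilbert_space smul ip"
    and "unital_cstar_algebra smul ip A"
    and "P \<in> projections ip A" and "Q \<in> projections ip A"
    and "\<exists>G. is_glb (le_op ip) (self_adjoints ip A) P Q G"
  shows "P o\<^sub>L Q = Q o\<^sub>L P"
  using hilbert_space.projections_glb_commute[OF assms(1)] assms(2-)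
  unfolding unital_cstar_algebra_def by blast

end
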